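(* Let $\varphi:[0,\infty)\to[0,\infty)$ be continuous and suppose there exists $t>0$ such that $\varphi^n(t)\to\infty$ as $n\to\infty$. Suppose also that $$\liminf_{t\to\infty}\varphi(t)<\infty.$$ If $a=(a_n)$ is a positive sequence such that $a_n\to\infty$ as $n\to\infty$, then there exist $t_a>0$ and $N_a\in\mathbb{N}$ such that $\varphi^n(t_a)\to\infty$ as $n\to\infty$ and $$\varphi^n(t_a)\le a_n,\quad\text{for } n\ge N_a.$$
   Context: $\varphi^n$ denotes the $n$th iterate of $\varphi$. *)

theory Defs
  imports "HOL-Analysis.Analysis"
begin

end

theory Submission
  imports Defs
begin

text \<open>
  Choose points \<open>s\<close> with \<open>\<phi> s\<close> bounded, as large as desired, and let \<open>p\<close> be the last point of the given
  escaping orbit that does not exceed \<open>s\<close>. Then \<open>[p, s]\<close> is covered by its own image, and the intervals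
  spanned by \<open>[p, s]\<close> and longer and longer pieces of the orbit of \<open>p\<close> cover each other in turn, never
  dropping below \<open>p\<close>, until they contain the interval \<open>[p', s']\<close> of the next stage. Every one of
  these intervals is covered by its own image, so the passage to the next stage can be delayed until
  \<open>a\<close> has outgrown everything this stage needs. A point whose orbit follows the resulting sequence
  of intervals escapes as slowly as required.
\<close>

text \<open>The points \<open>x\<close> whose iterates up to time \<open>n\<close> lie in the
  prescribed sets form a compact set \<open>F n\<close>. The covering hypothesis makes
  \<open>f ^^ n\<close> map \<open>F n\<close> onto \<open>E n\<close>, so \<open>F n\<close> is
  nonempty, and a decreasing sequence of nonempty compact sets has a common point.\<close>

lemma orbit_through_covering_compacts:
  fixes f :: "'a::t2_space \<Rightarrow> 'a" and E :: "nat \<Rightarrow> 'a set"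
  assumes compact: "\<And>n. compact (E n)" and nonempty: "\<And>n. E n \<noteq> {}"
    and cont: "\<And>n. continuous_on (E n) f"
    and cover: "\<And>n. E (Suc n) \<subseteq> f ` E n"
  obtains x where "\<And>n. (f ^^ n) x \<in> E n"
proof -
  define F where "F n = {x. \<forall>i\<le>n. (f ^^ i) x \<in> E i}" for n
  have F: "compact (F n) \<and> continuous_on (F n) (f ^^ n) \<and> (f ^^ n) ` F n = E n" for n
  proof (induction n)
    case 0
    have "F 0 = E 0" by (auto simp: F_def)
    then show ?case using compact[of 0] by (simp add: id_def)
  next
    case (Suc n)
    have F_Suc: "F (Suc n) = F n \<inter> (f ^^ Suc n) -` E (Suc n)"
      by (auto simp: F_def le_Suc_eq)
    have cont_Suc: "continuous_on (F n) (f ^^ Suc n)"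
      using Suc cont[of n] continuous_on_compose[of "F n" "f ^^ n" f] by simp
    have "compact (F (Suc n))"
    proof -
      have "closed (F (Suc n))"
        unfolding F_Suc using Suc compact
        by (intro continuous_closed_preimage[OF cont_Suc]) (auto intro: compact_imp_closed)
      moreover have "F (Suc n) = F n \<inter> F (Suc n)" using F_Suc by auto
      ultimately show ?thesis using Suc compact_Int_closed by metis
    qed
    moreover have "continuous_on (F (Suc n)) (f ^^ Suc n)"
      using cont_Suc F_Suc continuous_on_subset by blast
    moreover have "(f ^^ Suc n) ` F (Suc n) = E (Suc n)"
    proof -
      have "(f ^^ Suc n) ` F n = f ` E n"
        using Suc by (metis funpow.simps(2) image_comp)
      moreover have "(f ^^ Suc n) ` F (Suc n) = (f ^^ Suc n) ` F n \<inter> E (Suc n)"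
        unfolding F_Suc by (auto simp del: funpow.simps)
      ultimately show ?thesis using cover[of n] by auto
    qed
    ultimately show ?case by blast
  qed
  have "(\<Inter>n. F n) \<noteq> {}"
  proof (rule compact_space_imp_nest)
    show "compact_space (top_of_set (F 0))"
      using F[of 0] by (metis compact_space_subtopology compactin_euclidean_iff)
    show "closedin (top_of_set (F 0)) (F n)" for n
      using F[of n] by (intro closed_subset) (auto simp: F_def intro: compact_imp_closed)
    show "F n \<noteq> {}" for n
      using F[of n] nonempty[of n] by auto
    show "decseq F"
      by (auto simp: F_def decseq_def)
  qed
  then show thesis
    using that by (fastforce simp: F_def)
qed

text \<open>Growth and covering together make each \<open>A k i\<close> cover itself, so a walk
  through the sets may wait at \<open>A k (m k)\<close> for any length of time before it enters
  stage \<open>Suc k\<close>. Here \<open>N k\<close> is the earliest time at which stage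
  \<open>k\<close> may be entered; stage 0 is exempt, since the walk starts there.\<close>

lemma slow_passage_through_stages:
  fixes A :: "nat \<Rightarrow> nat \<Rightarrow> 'a set" and N :: "nat \<Rightarrow> nat"
  assumes grow: "\<And>k i. A k i \<subseteq> A k (Suc i)"
    and cover: "\<And>k i. A k (Suc i) \<subseteq> f ` A k i"
    and link: "\<And>k. A (Suc k) 0 \<subseteq> A k (m k)"
  obtains k i where "filterlim k at_top sequentially"
    and "\<And>n. k n = 0 \<or> N (k n) \<le> n" and "\<And>n. i n \<le> m (k n)"
    and "\<And>n. A (k (Suc n)) (i (Suc n)) \<subseteq> f ` A (k n) (i n)"
proof -
  \<comment> \<open>The time after this step is \<open>Suc n\<close>, hence the test
    \<open>N (Suc k) \<le> Suc n\<close>. The \<open>min\<close> realises the waiting: the position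
    stays at \<open>m k\<close> until the test succeeds.\<close>
  define step where "step n = (\<lambda>(k, i). if i = m k \<and> N (Suc k) \<le> Suc n
    then (Suc k, 0) else (k, min (Suc i) (m k)))" for n
  define st where "st = rec_nat (0, 0) step"
  define k where "k n = fst (st n)" for n
  define i where "i n = snd (st n)" for n
  have k0: "k 0 = 0" and i0: "i 0 = 0"
    by (simp_all add: k_def i_def st_def)
  have step_iff: "(k (Suc n), i (Suc n)) = (if i n = m (k n) \<and> N (Suc (k n)) \<le> Suc n
    then (Suc (k n), 0) else (k n, min (Suc (i n)) (m (k n))))" for n
    by (simp add: k_def i_def st_def step_def case_prod_beta)
  have k_Suc: "k (Suc n) = (if i n = m (k n) \<and> N (Suc (k n)) \<le> Suc n then Suc (k n) else k n)"
    and i_Suc: "i (Suc n) = (if i n = m (k n) \<and> N (Suc (k n)) \<le> Suc n then 0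
      else min (Suc (i n)) (m (k n)))" for n
    using step_iff[of n] by (auto split: if_splits)
  have i_le: "i n \<le> m (k n)" for n
    by (induction n) (auto simp: i0 k_Suc i_Suc)
  have N_le: "k n = 0 \<or> N (k n) \<le> n" for n
    by (induction n) (auto simp: k0 k_Suc)
  have cover_n: "A (k (Suc n)) (i (Suc n)) \<subseteq> f ` A (k n) (i n)" for n
  proof -
    have "A (k n) (i n) \<subseteq> f ` A (k n) (i n)"
      using grow cover by blast
    moreover from this have "A (Suc (k n)) 0 \<subseteq> f ` A (k n) (i n)" if "i n = m (k n)"
      using link[of "k n"] that by (metis order_trans)
    moreover have "min (Suc (i n)) (m (k n)) = i n \<or> min (Suc (i n)) (m (k n)) = Suc (i n)"
      using i_le[of n] by linarith
    ultimately show ?thesis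
      using cover[of "k n" "i n"] unfolding k_Suc i_Suc by (smt (verit))
  qed
  have "mono k"
    by (simp add: mono_iff_le_Suc k_Suc)
  have unbounded: "\<exists>n. K \<le> k n" for K
  proof (induction K)
    case (Suc K)
    then obtain n where n: "K \<le> k n" by blast
    show ?case
    proof (rule ccontr)
      assume "\<nexists>n. Suc K \<le> k n"
      then have le: "k j \<le> K" for j by (meson not_less_eq_eq)
      have k_eq: "k (n + d) = K" for d
        using n le[of "n + d"] monoD[OF \<open>mono k\<close>, of n "n + d"] by simp
      have no_switch: "\<not> (i (n + d) = m K \<and> N (Suc K) \<le> Suc (n + d))" for d
        using k_Suc[of "n + d"] k_eq[of d] k_eq[of "Suc d"] by (auto split: if_splits)
      \<comment> \<open>A walk that never left stage \<open>K\<close> would climb to position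
        \<open>m K\<close> and stay there, so after \<open>m K + N (Suc K)\<close> further steps
        both conditions for switching would hold.\<close>
      have "min d (m K) \<le> i (n + d)" for d
      proof (induction d)
        case (Suc d)
        then show ?case
          using i_Suc[of "n + d"] no_switch[of d] k_eq[of d] by auto
      qed simp
      from this[of "m K + N (Suc K)"] have "i (n + (m K + N (Suc K))) = m K"
        using i_le[of "n + (m K + N (Suc K))"] k_eq[of "m K + N (Suc K)"] by simp
      then show False
        using no_switch[of "m K + N (Suc K)"] by simp
    qed
  qed simp
  have "filterlim k at_top sequentially"
    unfolding filterlim_at_top eventually_sequentially
    using unbounded \<open>mono k\<close> by (meson monoD order_trans)
  then show thesis using that N_le i_le cover_n by blast
qed

text \<open>Take \<open>U i\<close> to be the maximum of \<open>s\<close> and the first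
  \<open>i\<close> iterates of \<open>p\<close>. Then \<open>[p, U i]\<close> contains
  \<open>s\<close>, whose image is at most \<open>p\<close>, and a point whose image is at least
  \<open>U (Suc i)\<close>; the intermediate value theorem gives the rest.\<close>

lemma covering_intervals_along_orbit:
  fixes \<phi> :: "real \<Rightarrow> real" and p s :: real
  assumes cont: "continuous_on {p..} \<phi>" and "p \<le> s" "\<phi> s \<le> p"
    and beyond: "\<And>j. 0 < j \<Longrightarrow> s < (\<phi> ^^ j) p"
  obtains U where "U 0 = s" and "mono U" and "\<And>j. 0 < j \<Longrightarrow> (\<phi> ^^ j) p \<le> U j"
    and "\<And>i. {p..U (Suc i)} \<subseteq> \<phi> ` {p..U i}"
proof -
  define U where "U i = Max (insert s ((\<lambda>j. (\<phi> ^^ j) p) ` {1..i}))" for i :: nat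
  have U0: "U 0 = s" by (simp add: U_def)
  have mono: "mono U"
    unfolding U_def by (intro monoI Max_mono) auto
  have orbit_le: "(\<phi> ^^ j) p \<le> U i" if "0 < j" "j \<le> i" for i j
    unfolding U_def using that by (intro Max_ge) auto
  have s_le: "s \<le> U i" for i
    unfolding U_def by (intro Max_ge) auto
  have U_Suc_le: "\<exists>x\<in>{p..U i}. U (Suc i) \<le> \<phi> x" for i
  proof -
    have "U (Suc i) \<in> insert s ((\<lambda>j. (\<phi> ^^ j) p) ` {1..Suc i})"
      unfolding U_def by (intro Max_in) auto
    \<comment> \<open>This rules out \<open>s\<close> as the maximum, which is therefore an iterate
      of \<open>p\<close>; the preceding point of the orbit, possibly \<open>p\<close> itself, is
      the required \<open>x\<close>.\<close>
    moreover have "s < U (Suc i)"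
      using beyond[of 1] orbit_le[of 1 "Suc i"] by simp
    ultimately obtain j where j: "1 \<le> j" "j \<le> Suc i" "U (Suc i) = (\<phi> ^^ j) p"
      by auto
    then obtain j' where j': "j = Suc j'" by (cases j) auto
    have "(\<phi> ^^ j') p \<in> {p..U i}"
    proof (cases "j' = 0")
      case True
      then show ?thesis using \<open>p \<le> s\<close> s_le[of i] by simp
    next
      case False
      then show ?thesis using beyond[of j'] \<open>p \<le> s\<close> orbit_le[of j' i] j j' by simp
    qed
    then show ?thesis using j j' by (intro bexI[of _ "(\<phi> ^^ j') p"]) auto
  qed
  have "{p..U (Suc i)} \<subseteq> \<phi> ` {p..U i}" for i
  proof -
    obtain x where x: "x \<in> {p..U i}" "U (Suc i) \<le> \<phi> x" using U_Suc_le by blast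
    have "connected (\<phi> ` {p..U i})"
      using cont by (intro connected_continuous_image connected_Icc) (auto elim: continuous_on_subset)
    moreover have "\<phi> s \<in> \<phi> ` {p..U i}" using \<open>p \<le> s\<close> s_le by auto
    moreover have "\<phi> x \<in> \<phi> ` {p..U i}" using x by blast
    ultimately have "{\<phi> s..\<phi> x} \<subseteq> \<phi> ` {p..U i}"
      by (rule connected_contains_Icc)
    then show ?thesis using x(2) \<open>\<phi> s \<le> p\<close> by fastforce
  qed
  then show thesis using that U0 mono orbit_le by blast
qed

theorem theorem2p2:
  fixes \<phi> :: "real \<Rightarrow> real" and a :: "nat \<Rightarrow> real"
  assumes maps: "\<phi> \<in> {0..} \<rightarrow> {0..}"
    and cont: "continuous_on {0..} \<phi>"
    and esc: "\<exists>t>0. filterlim (\<lambda>n. (\<phi> ^^ n) t) at_top sequentially"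
    and liminf: "Liminf at_top (\<lambda>t. ereal (\<phi> t)) < \<infinity>"
    and a_pos: "\<And>n. a n > 0"
    and a_lim: "filterlim a at_top sequentially"
  shows "\<exists>t\<^sub>a>0. \<exists>N\<^sub>a::nat.
           filterlim (\<lambda>n. (\<phi> ^^ n) t\<^sub>a) at_top sequentially \<and>
           (\<forall>n\<ge>N\<^sub>a. (\<phi> ^^ n) t\<^sub>a \<le> a n)"
proof -
  obtain t where t: "filterlim (\<lambda>n. (\<phi> ^^ n) t) at_top sequentially"
    using esc by blast
  obtain L where L: "Liminf at_top (\<lambda>t. ereal (\<phi> t)) < ereal L"
    using liminf ereal_dense2 by blast
  have low: "\<exists>s\<ge>M. \<phi> s \<le> L" for M
  proof (rule ccontr)
    assume "\<not> (\<exists>s\<ge>M. \<phi> s \<le> L)"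
    then have "eventually (\<lambda>s. ereal L \<le> ereal (\<phi> s)) at_top"
      unfolding eventually_at_top_linorder by (intro exI[of _ M]) force
    then have "ereal L \<le> Liminf at_top (\<lambda>t. ereal (\<phi> t))"
      by (rule Liminf_bounded)
    then show False using L by simp
  qed
  define good where "good = (\<lambda>(p, s). 0 < p \<and> p \<le> s \<and> \<phi> s \<le> p \<and>
    (\<forall>j>0. s < (\<phi> ^^ j) p) \<and> filterlim (\<lambda>n. (\<phi> ^^ n) p) at_top sequentially)"
  have ex_good: "\<exists>p s. good (p, s) \<and> M \<le> p" for M
  proof -
    \<comment> \<open>A point \<open>p\<close> above \<open>M'\<close> satisfies
      \<open>\<phi> s \<le> L \<le> p\<close> as well as \<open>0 < p\<close>.\<close>
    define M' where "M' = max M (max L 1)"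
    obtain n0 where n0: "\<And>n. n0 \<le> n \<Longrightarrow> M' \<le> (\<phi> ^^ n) t"
      using t unfolding filterlim_at_top eventually_sequentially by meson
    \<comment> \<open>Since \<open>s\<close> is not below the iterate at time \<open>n0\<close>, the
      last time the orbit is at most \<open>s\<close> is \<open>n0\<close> or later, when the orbit
      is already above \<open>M'\<close>.\<close>
    obtain s where s: "(\<phi> ^^ n0) t \<le> s" "\<phi> s \<le> L"
      using low by blast
    obtain b where b: "\<And>n. b \<le> n \<Longrightarrow> s + 1 \<le> (\<phi> ^^ n) t"
      using t unfolding filterlim_at_top eventually_sequentially by meson
    define n where "n = (GREATEST n. (\<phi> ^^ n) t \<le> s)"
    have bound: "n' \<le> b" if "(\<phi> ^^ n') t \<le> s" for n'
      using b[of n'] that by linarith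
    have n: "(\<phi> ^^ n) t \<le> s"
      unfolding n_def using s(1) bound by (rule GreatestI_nat)
    have after: "s < (\<phi> ^^ n') t" if "n < n'" for n'
      using Greatest_le_nat[of "\<lambda>n. (\<phi> ^^ n) t \<le> s" n' b] bound that
      unfolding n_def by fastforce
    have "n0 \<le> n"
      using Greatest_le_nat[of "\<lambda>n. (\<phi> ^^ n) t \<le> s" n0 b] bound s(1)
      unfolding n_def by blast
    then have "M' \<le> (\<phi> ^^ n) t" by (rule n0)
    moreover have "(\<phi> ^^ j) ((\<phi> ^^ n) t) = (\<phi> ^^ (j + n)) t" for j
      by (simp add: funpow_add)
    moreover have "filterlim (\<lambda>j. (\<phi> ^^ (j + n)) t) at_top sequentially"
      using t by (rule filterlim_compose) (rule filterlim_add_const_nat_at_top)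
    ultimately have "good ((\<phi> ^^ n) t, s) \<and> M \<le> (\<phi> ^^ n) t"
      using n s(2) after by (simp add: good_def M'_def)
    then show ?thesis by blast
  qed
  \<comment> \<open>The bound \<open>real k\<close> will force escape; monotonicity of the left ends
    lets the intervals of one stage contain the first interval of the next.\<close>
  have "\<exists>q. \<forall>k. (good (q k) \<and> real k \<le> fst (q k)) \<and> fst (q k) \<le> fst (q (Suc k))"
  proof (rule dependent_nat_choice)
    show "\<exists>x. good x \<and> real 0 \<le> fst x"
      using ex_good[of 0] by force
    show "\<exists>y. (good y \<and> real (Suc n) \<le> fst y) \<and> fst x \<le> fst y" for x n
      using ex_good[of "max (real (Suc n)) (fst x)"] by force
  qed
  then obtain q where q: "\<And>k. good (q k)" "\<And>k. real k \<le> fst (q k)"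
    "\<And>k. fst (q k) \<le> fst (q (Suc k))" by blast
  define p where "p k = fst (q k)" for k
  define s where "s k = snd (q k)" for k
  have p_pos: "0 < p k" and p_le: "p k \<le> s k" and image_s: "\<phi> (s k) \<le> p k"
    and beyond: "\<And>j. 0 < j \<Longrightarrow> s k < (\<phi> ^^ j) (p k)"
    and p_esc: "filterlim (\<lambda>n. (\<phi> ^^ n) (p k)) at_top sequentially" for k
    using q(1)[of k] by (auto simp: good_def p_def s_def case_prod_beta)
  have cont_p: "continuous_on {p k..} \<phi>" for k
    using cont by (rule continuous_on_subset) (use p_pos[of k] in auto)
  have "\<exists>U. U 0 = s k \<and> mono U \<and> (\<forall>j>0. (\<phi> ^^ j) (p k) \<le> U j) \<and>
    (\<forall>i. {p k..U (Suc i)} \<subseteq> \<phi> ` {p k..U i})" for k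
    by (rule covering_intervals_along_orbit[OF cont_p p_le image_s beyond]) blast+
  then obtain U where U0: "\<And>k. U k 0 = s k" and U_mono: "\<And>k. mono (U k)"
    and U_orbit: "\<And>k j. 0 < j \<Longrightarrow> (\<phi> ^^ j) (p k) \<le> U k j"
    and U_cover: "\<And>k i. {p k..U k (Suc i)} \<subseteq> \<phi> ` {p k..U k i}"
    by metis
  have "\<exists>j. s (Suc k) \<le> U k j" for k
  proof -
    have "eventually (\<lambda>j. s (Suc k) \<le> (\<phi> ^^ j) (p k)) sequentially"
      using p_esc by (simp add: filterlim_at_top)
    then have "eventually (\<lambda>j. s (Suc k) \<le> (\<phi> ^^ j) (p k) \<and> 0 < j) sequentially"
      using eventually_gt_at_top eventually_conj by blast
    then obtain j where "s (Suc k) \<le> (\<phi> ^^ j) (p k)" "0 < j"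
      using eventually_happens' sequentially_bot by blast
    then show ?thesis using U_orbit order_trans by blast
  qed
  then obtain m where m: "\<And>k. s (Suc k) \<le> U k (m k)" by metis
  \<comment> \<open>\<open>U k (m k)\<close> is the largest right end used in stage
    \<open>k\<close>, so \<open>N k\<close> is a time from which all of that stage lies below
    \<open>a\<close>.\<close>
  have "\<exists>N. \<forall>n\<ge>N. U k (m k) \<le> a n" for k
    using a_lim unfolding filterlim_at_top eventually_sequentially by blast
  then obtain N where N: "\<And>k n. N k \<le> n \<Longrightarrow> U k (m k) \<le> a n" by metis
  obtain k i where k_lim: "filterlim k at_top sequentially"
    and N_le: "\<And>n. k n = 0 \<or> N (k n) \<le> n" and i_le: "\<And>n. i n \<le> m (k n)"
    and cover: "\<And>n. {p (k (Suc n))..U (k (Suc n)) (i (Suc n))} \<subseteq> \<phi> ` {p (k n)..U (k n) (i n)}"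
  proof (rule slow_passage_through_stages[of "\<lambda>k i. {p k..U k i}" \<phi> m N])
    show "{p k..U k i} \<subseteq> {p k..U k (Suc i)}" for k i
      using monoD[OF U_mono, of i "Suc i" k] by auto
    show "{p (Suc k)..U (Suc k) 0} \<subseteq> {p k..U k (m k)}" for k
      using q(3)[of k] m[of k] by (auto simp: U0 p_def)
  qed (use U_cover in auto)
  obtain x where x: "\<And>n. (\<phi> ^^ n) x \<in> {p (k n)..U (k n) (i n)}"
  proof (rule orbit_through_covering_compacts[of "\<lambda>n. {p (k n)..U (k n) (i n)}" \<phi>])
    show "{p (k n)..U (k n) (i n)} \<noteq> {}" for n
      using p_le[of "k n"] monoD[OF U_mono, of 0 "i n" "k n"] by (simp add: U0)
    show "continuous_on {p (k n)..U (k n) (i n)} \<phi>" for n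
      using cont_p by (rule continuous_on_subset) auto
  qed (use cover in auto)
  have "0 < x"
    using x[of 0] p_pos[of "k 0"] by simp
  \<comment> \<open>The left ends alone suffice: the orbit at time \<open>n\<close> is at least
    \<open>p (k n)\<close>, hence at least \<open>k n\<close>.\<close>
  moreover have "filterlim (\<lambda>n. (\<phi> ^^ n) x) at_top sequentially"
  proof (rule filterlim_at_top_mono)
    show "filterlim (\<lambda>n. real (k n)) at_top sequentially"
      using filterlim_real_sequentially k_lim by (rule filterlim_compose)
    show "eventually (\<lambda>n. real (k n) \<le> (\<phi> ^^ n) x) sequentially"
      using x q(2) by (intro always_eventually allI) (auto simp: p_def intro: order_trans)
  qed
  \<comment> \<open>Starting at \<open>N 0\<close> takes care of stage 0, which is entered without
    waiting; every later stage \<open>k\<close> is entered no earlier than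
    \<open>N k\<close>.\<close>
  moreover have "(\<phi> ^^ n) x \<le> a n" if "N 0 \<le> n" for n
  proof -
    have "(\<phi> ^^ n) x \<le> U (k n) (m (k n))"
      using x[of n] monoD[OF U_mono i_le[of n], of "k n"] by simp
    also have "\<dots> \<le> a n"
      using N N_le[of n] that by metis
    finally show ?thesis .
  qed
  ultimately show ?thesis by blast
qed

end
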